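(* Let $\Theta$ and $\mathcal C$ be the polyhedra $\Theta=\{x\in\mathbb R^n\mid \langle a_i,x\rangle\le b_i\ \forall i\in I_1\}$ and $\mathcal C=\{x\in\mathbb R^n\mid \langle a_i,x\rangle\le 0\ \forall i\in I_2\}$, and let $\mathcal N$ be the normal cone mapping to $\Theta$. Let $\bar x\in\mathcal C$ and $(\bar x,\bar x^* )\in\operatorname{gph}\mathcal N$, let $\bar I:=I(\bar x)$, and let $G:\mathbb R^n\rightrightarrows\mathbb R^n$ be defined by $G(x):=\{y\mid y\in-\bar x^*+N(x,\Theta)\}$. The following assertions hold. (i) $G$ satisfies the Aubin property with respect to $\mathcal C$ at $(\bar x,0)$ if and only if for all $Q\subset\bar I$ and $P\in\mathcal P(\bar x,\bar x^* )$ with $C_Q\ne\emptyset$ and $P\subset Q|_{I_1}$, the following implication holds: $$(v,0)\in(A_{Q,P}\cap\mathcal T_{Q|_{I_2}})\times B_{Q|_{I_1},P}\implies v=0.$$ (ii) If, in addition, the generating vectors $a_i$, $i\in I(\bar x)$, are linearly independent, then $G$ satisfies the Aubin property with respect to $\mathcal C$ at $(\bar x,0)$ if and only if for all $Q\subset\bar I$ and all $P$ with $\mathcal I(\bar x,\bar x^* )\subset P\subset Q|_{I_1}$, the following implication holds: $$(v,0)\in(A_{Q,P}\cap\mathcal T_{Q|_{I_2}})\times B_{Q|_{I_1},P}\implies v=0.$$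
   Context: Setting: $I_1=\{1,\dots,\ell_1\}$, $I_2=\{\ell_1+1,\dots,\ell\}$, $I=I_1\cup I_2$; $a_i\in\mathbb R^n$ for $i\in I$, $b_i\in\mathbb R$ for $i\in I_1$. Active index sets: $I_1(x)=\{i\in I_1\mid\langle a_i,x\rangle=b_i\}$ for $x\in\Theta$; $I_2(x)=\{i\in I_2\mid\langle a_i,x\rangle=0\}$ for $x\in\mathcal C$; $I(x)=I_1(x)\cup I_2(x)$ for $x\in\Theta\cap\mathcal C$. Normal cone mapping: $\mathcal N(x)=N(x,\Theta)$ (the usual normal cone to the convex set $\Theta$, equal to $\operatorname{cone}\{a_i\mid i\in I_1(x)\}$) if $x\in\Theta$, and $\mathcal N(x)=N(x,\Theta)=\emptyset$ otherwise; $\operatorname{gph}\mathcal N=\{(x,x^* )\mid x^*\in\mathcal N(x)\}$. Index set $\mathcal I(\bar x,\bar x^* )$: since $\bar x^*\in N(\bar x,\Theta)$, there are a set $\mathcal I\subset I_1(\bar x)$ and numbers $\lambda_i\ge 0$ ($i\in\mathcal I$) with $\bar x^*=\sum_{i\in\mathcal I}\lambda_ia_i$; fixing such a representation, $\mathcal I(\bar x,\bar x^* ):=\{i\in\mathcal I\mid\lambda_i>0\}$. For $Q\subset I$: $Q|_{I_j}=Q\cap I_j$ ($j=1,2$), $\mathcal T_Q=\{u\in\mathbb R^n\mid\langle a_i,u\rangle\le 0\ \forall i\in Q\}$, and $C_Q=\{x\in\mathbb R^n\mid\langle a_i,x\rangle=0\ \forall i\in Q,\ \langle a_i,x\rangle<0\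 \forall i\in I\setminus Q\}$. For $P\subset Q\subset I$ with $P\subset I_1$: $B_{Q,P}=\{u\in\mathcal T_Q\mid\langle a_i,u\rangle=0\ \forall i\in P\}$, $A_{Q,P}=\operatorname{cone}\{a_i\mid i\in Q\setminus P\}+\operatorname{span}\{a_i\mid i\in P\}$. Also $\mathcal P(\bar x,\bar x^* )=\{P\subset I_1(\bar x)\mid\bar x^*\in\operatorname{cone}\{a_i\mid i\in P\}\}$. Here $\operatorname{cone}$ is the convex cone generated (nonnegative combinations), $\operatorname{cone}\emptyset=\operatorname{span}\emptyset=\{0\}$, $\mathcal T_\emptyset=\mathbb R^n$. Aubin property: $F:\mathbb R^n\rightrightarrows\mathbb R^m$ has the Aubin property with respect to $\mathcal C$ at (around) $(\bar x,\bar y)\in\operatorname{gph}F$ if $\operatorname{gph}F$ is locally closed around $(\bar x,\bar y)$ and there exist $\kappa\ge0$ and neighborhoods $V$ of $\bar y$ and $U$ of $\bar x$ such that $F(u)\cap V\subset F(x)+\kappa\|u-x\|\mathbb B$ for all $x,u\in\mathcal C\cap U$, where $\mathbb B$ is the closed unit ball.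
   Formalization: In (i), C_Q is taken with strict inequalities only for i in Ī∖Q rather than I∖Q; with I∖Q assertion (i) fails, e.g. Θ=[-1,0], C=ℝ, x̄=x̄*=0, where every C_Q with Q⊂Ī is empty yet the Aubin property fails. *)

theory Defs
  imports "HOL-Analysis.Analysis"
begin

definition gph :: "('a \<Rightarrow> 'b set) \<Rightarrow> ('a \<times> 'b) set" where
  "gph F = {(x, y). y \<in> F x}"

definition normal_cone :: "'a::real_inner set \<Rightarrow> 'a \<Rightarrow> 'a set" where
  "normal_cone S x = (if x \<in> S then {w. \<forall>y\<in>S. w \<bullet> (y - x) \<le> 0} else {})"

definition locally_closed_around :: "'a::topological_space set \<Rightarrow> 'a \<Rightarrow> bool" where
  "locally_closed_around S z \<longleftrightarrow> (\<exists>W. closed W \<and> z \<in> interior W \<and> closed (S \<inter> W))"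

definition aubin_wrt ::
    "('a::real_normed_vector \<Rightarrow> 'b::real_normed_vector set) \<Rightarrow> 'a set \<Rightarrow> 'a \<Rightarrow> 'b \<Rightarrow> bool" where
  "aubin_wrt F C xbar ybar \<longleftrightarrow>
     (xbar, ybar) \<in> gph F \<and>
     locally_closed_around (gph F) (xbar, ybar) \<and>
     (\<exists>\<kappa>\<ge>0. \<exists>U V. open U \<and> xbar \<in> U \<and> open V \<and> ybar \<in> V \<and>
        (\<forall>x \<in> C \<inter> U. \<forall>u \<in> C \<inter> U.
           F u \<inter> V \<subseteq> F x + (*\<^sub>R) (\<kappa> * norm (u - x)) ` cball 0 1))"

definition active :: "nat set \<Rightarrow> (nat \<Rightarrow> 'a::real_inner) \<Rightarrow> (nat \<Rightarrow> real) \<Rightarrow> 'a \<Rightarrow> nat set" where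
  "active J a b x = {i \<in> J. a i \<bullet> x = b i}"

definition T_set :: "(nat \<Rightarrow> 'a::real_inner) \<Rightarrow> nat set \<Rightarrow> 'a set" where
  "T_set a Q = {u. \<forall>i\<in>Q. a i \<bullet> u \<le> 0}"

text \<open>
  The index set \<open>J\<close>, from which the sets \<open>Q\<close> are drawn, is a parameter. For the
  localization at a point \<open>x\<close> of a polyhedron it has to be the set of indices active at \<open>x\<close>:
  the inequalities below are homogeneous, so a constraint that is inactive at \<open>x\<close> could make
  the set empty although it plays no role near \<open>x\<close>. For instance, for the interval \<open>[-1, 0]\<close>,
  i.e. \<open>1 * x \<le> 0\<close> and \<open>(-1) * x \<le> 1\<close>, no \<open>Q\<close> contained in the active set at \<open>0\<close> would give a
  nonempty set if \<open>J\<close> contained both indices.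
\<close>
definition C_set :: "(nat \<Rightarrow> 'a::real_inner) \<Rightarrow> nat set \<Rightarrow> nat set \<Rightarrow> 'a set" where
  "C_set a J Q = {x. (\<forall>i\<in>Q. a i \<bullet> x = 0) \<and> (\<forall>i\<in>J - Q. a i \<bullet> x < 0)}"

definition B_set :: "(nat \<Rightarrow> 'a::real_inner) \<Rightarrow> nat set \<Rightarrow> nat set \<Rightarrow> 'a set" where
  "B_set a Q P = {u \<in> T_set a Q. \<forall>i\<in>P. a i \<bullet> u = 0}"

definition A_set :: "(nat \<Rightarrow> 'a::real_inner) \<Rightarrow> nat set \<Rightarrow> nat set \<Rightarrow> 'a set" where
  "A_set a Q P = convex_cone hull (a ` (Q - P)) + span (a ` P)"

definition P_sets ::
    "nat set \<Rightarrow> (nat \<Rightarrow> 'a::real_inner) \<Rightarrow> (nat \<Rightarrow> real) \<Rightarrow> 'a \<Rightarrow> 'a \<Rightarrow> nat set set" where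
  "P_sets I1 a b x xs = {P. P \<subseteq> active I1 a b x \<and> xs \<in> convex_cone hull (a ` P)}"

end

theory Submission
  imports Defs
begin

text \<open>
  Let \<open>K\<^sub>1\<close>, \<open>K\<^sub>2\<close> be the sets of indices of \<open>I1\<close>, \<open>I2\<close> that are active at \<open>xbar\<close>. Both sides of (i) are
  equivalent to the condition that \<open>a i\<close> vanishes on the tangent cone \<open>T_set a K\<^sub>2\<close> of \<open>C\<close> for every
  \<open>i \<in> K\<^sub>1\<close>. Under this condition the normal cone to \<open>\<Theta>\<close> is constant on \<open>C\<close> near \<open>xbar\<close>. Conversely,
  along \<open>xbar + t w\<close> with \<open>w\<close> tangent to \<open>C\<close>, the Aubin property applied to \<open>xs + \<epsilon> a i\<close> and \<open>t \<rightarrow> 0\<close>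
  yields \<open>a i \<bullet> w = 0\<close>. On the other side, choosing \<open>w\<close> in the relative interior of the set of
  directions of \<open>T_set a K\<^sub>2\<close> orthogonal to all \<open>a i\<close>, \<open>i \<in> K\<^sub>1\<close>, and \<open>Q\<close> as the set of indices active
  at \<open>w\<close>, the cone \<open>A_set a Q K\<^sub>1\<close> is a linear subspace, and projecting \<open>T_set a K\<^sub>2\<close> onto it gives the
  condition. If the active vectors are linearly independent, both sides of (ii) say that \<open>K\<^sub>1\<close> is empty.
\<close>

section \<open>Farkas' lemma and the local geometry of polyhedra\<close>

text \<open>The cone of a finite set is closed, so a point outside it is strictly separated from it.
  The separating functional, being bounded below on a cone, is nonnegative there, so its negative
  lies in the polar of \<open>X\<close>.\<close>

lemma convex_cone_hull_farkas:
  fixes X :: "'a::euclidean_space set"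
  assumes "finite X" and polar: "\<And>y. (\<And>x. x \<in> X \<Longrightarrow> x \<bullet> y \<le> 0) \<Longrightarrow> z \<bullet> y \<le> 0"
  shows "z \<in> convex_cone hull X"
proof (rule ccontr)
  let ?H = "convex_cone hull X"
  assume "z \<notin> ?H"
  then obtain c \<beta> where c: "c \<bullet> z < \<beta>" "\<And>x. x \<in> ?H \<Longrightarrow> c \<bullet> x > \<beta>"
    using separating_hyperplane_closed_point[of ?H z] convex_convex_cone_hull
      closed_convex_cone_hull[OF assms(1)] by blast
  have neg: "\<beta> < 0"
    using c(2)[OF convex_cone_hull_contains_0] by simp
  have "x \<bullet> (- c) \<le> 0" if "x \<in> X" for x
  proof (rule ccontr)
    assume "\<not> ?thesis"
    then have lt: "c \<bullet> x < 0" by (simp add: inner_commute)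
    \<comment> \<open>Rescaling \<open>x\<close> stays in the cone and gives \<open>c\<close> the
      value \<open>\<beta>\<close> exactly, which strict separation excludes.\<close>
    then have "(\<beta> / (c \<bullet> x)) *\<^sub>R x \<in> ?H"
      using neg that by (intro convex_cone_hull_mul hull_inc) (auto simp: divide_nonpos_neg)
    from c(2)[OF this] show False using lt by simp
  qed
  from polar[OF this] have "c \<bullet> z \<ge> 0" by (simp add: inner_commute)
  with c(1) neg show False by linarith
qed

lemma inner_convex_cone_hull_nonpos:
  assumes "x \<in> convex_cone hull X" and "\<And>z. z \<in> X \<Longrightarrow> z \<bullet> y \<le> 0"
  shows "x \<bullet> y \<le> 0"
proof -
  have "convex_cone hull X \<subseteq> {x. y \<bullet> x \<le> 0}"
    using assms(2) by (intro hull_minimal convex_cone_halfspace_le) (auto simp: inner_commute)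
  with assms(1) show ?thesis by (auto simp: inner_commute)
qed

lemma inner_span_eq_0:
  assumes "x \<in> span X" and "\<And>z. z \<in> X \<Longrightarrow> z \<bullet> y = 0"
  shows "x \<bullet> y = 0"
  using assms(1) by (induction rule: span_induct_alt) (auto simp: inner_add_left assms(2))

lemma strict_inequalities_stable:
  fixes a :: "'i \<Rightarrow> 'a::real_inner"
  assumes "finite J" and "\<And>i. i \<in> J \<Longrightarrow> a i \<bullet> x < b i"
  obtains r where "r > 0" and "\<And>y i. y \<in> ball x r \<Longrightarrow> i \<in> J \<Longrightarrow> a i \<bullet> y < b i"
proof -
  let ?S = "\<Inter>i\<in>J. {y. a i \<bullet> y < b i}"
  have "open ?S" using assms(1) by (auto intro: open_halfspace_lt)
  moreover have "x \<in> ?S" using assms(2) by auto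
  ultimately obtain r where r: "r > 0" "ball x r \<subseteq> ?S"
    using open_contains_ball by blast
  show thesis by (rule that[OF r(1)]) (use r(2) in blast)
qed

text \<open>Used to correct a vector on the constraints outside \<open>Q\<close> by a multiple of
  \<open>w\<close>, while those in \<open>Q\<close>, tight at \<open>w\<close>, do not
  notice.\<close>

lemma strict_direction_dominates:
  fixes a :: "'i \<Rightarrow> 'a::real_inner"
  assumes "finite J" and "\<And>i. i \<in> J \<Longrightarrow> a i \<bullet> w < 0"
  obtains t where "t \<ge> 0" and "\<And>i. i \<in> J \<Longrightarrow> a i \<bullet> (v + t *\<^sub>R w) \<le> 0"
proof
  \<comment> \<open>The ratio \<open>?f i\<close> is a multiplier that suffices for constraint
    \<open>i\<close>; the sum dominates each of them and is 0 for empty \<open>J\<close>.\<close>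
  let ?f = "\<lambda>i. \<bar>a i \<bullet> v\<bar> / - (a i \<bullet> w)"
  have nonneg: "?f i \<ge> 0" if "i \<in> J" for i
    using assms(2)[OF that] by (intro divide_nonneg_pos) auto
  show "sum ?f J \<ge> 0" using nonneg by (rule sum_nonneg)
  fix i assume i: "i \<in> J"
  have "?f i \<le> sum ?f J"
    by (rule member_le_sum) (use i assms(1) nonneg in auto)
  then have "\<bar>a i \<bullet> v\<bar> \<le> sum ?f J * - (a i \<bullet> w)"
    using assms(2)[OF i] by (subst (asm) pos_divide_le_eq) auto
  then show "a i \<bullet> (v + sum ?f J *\<^sub>R w) \<le> 0"
    by (simp add: inner_add_right)
qed

text \<open>Active constraints do not increase along \<open>w\<close>, and inactive ones have slack
  for short steps.\<close>

lemma tangent_direction_feasible: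
  fixes a :: "nat \<Rightarrow> 'a::real_inner"
  assumes "finite J" and "\<And>i. i \<in> J \<Longrightarrow> a i \<bullet> x \<le> b i" and "w \<in> T_set a (active J a b x)"
  obtains r where "r > 0" and "\<And>t. 0 \<le> t \<Longrightarrow> t < r \<Longrightarrow> \<forall>i\<in>J. a i \<bullet> (x + t *\<^sub>R w) \<le> b i"
proof -
  have "a i \<bullet> x < b i" if "i \<in> J - active J a b x" for i
    using that assms(2)[of i] by (auto simp: active_def)
  then obtain r where r: "r > 0"
    "\<And>y i. y \<in> ball x r \<Longrightarrow> i \<in> J - active J a b x \<Longrightarrow> a i \<bullet> y < b i"
    using strict_inequalities_stable[of "J - active J a b x" a x b] assms(1) by blast
  show thesis
  \<comment> \<open>The extra 1 avoids division by zero when \<open>w = 0\<close>.\<close>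
  proof (rule that[of "r / (norm w + 1)"])
    show "r / (norm w + 1) > 0"
      using r(1) by (intro divide_pos_pos) (auto intro: add_nonneg_pos)
    fix t :: real assume t: "0 \<le> t" "t < r / (norm w + 1)"
    have "t * (norm w + 1) < r"
      using t(2) by (subst (asm) pos_less_divide_eq) (auto intro: add_nonneg_pos)
    then have "x + t *\<^sub>R w \<in> ball x r"
      using t(1) by (simp add: dist_norm algebra_simps)
    then have "a i \<bullet> (x + t *\<^sub>R w) \<le> b i" if "i \<in> J - active J a b x" for i
      using r(2)[OF _ that] by (simp add: less_imp_le)
    moreover have "a i \<bullet> (x + t *\<^sub>R w) \<le> b i" if "i \<in> active J a b x" for i
    proof -
      have "a i \<bullet> w \<le> 0" "a i \<bullet> x = b i"
        using that assms(3) by (auto simp: T_set_def active_def)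
      then show ?thesis using t(1) by (simp add: inner_add_right mult_nonneg_nonpos)
    qed
    ultimately show "\<forall>i\<in>J. a i \<bullet> (x + t *\<^sub>R w) \<le> b i" by blast
  qed
qed

text \<open>By Farkas it suffices to test \<open>xs\<close> on directions along which no active
  constraint increases; short steps in them are feasible, so normality applies.\<close>

lemma normal_cone_polyhedron_subset:
  fixes a :: "nat \<Rightarrow> 'a::euclidean_space"
  assumes "finite J" and "xs \<in> normal_cone {x. \<forall>i\<in>J. a i \<bullet> x \<le> b i} x"
  shows "xs \<in> convex_cone hull (a ` active J a b x)"
proof (rule convex_cone_hull_farkas)
  show "finite (a ` active J a b x)" using assms(1) by (simp add: active_def)
  fix y assume "\<And>z. z \<in> a ` active J a b x \<Longrightarrow> z \<bullet> y \<le> 0"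
  then have y: "y \<in> T_set a (active J a b x)" by (auto simp: T_set_def)
  have xs: "\<And>z. \<forall>i\<in>J. a i \<bullet> z \<le> b i \<Longrightarrow> xs \<bullet> (z - x) \<le> 0" and x: "\<And>i. i \<in> J \<Longrightarrow> a i \<bullet> x \<le> b i"
    using assms(2) by (auto simp: normal_cone_def split: if_splits)
  obtain r where r: "r > 0" "\<And>t. 0 \<le> t \<Longrightarrow> t < r \<Longrightarrow> \<forall>i\<in>J. a i \<bullet> (x + t *\<^sub>R y) \<le> b i"
    using tangent_direction_feasible[OF assms(1) x y] by blast
  have "xs \<bullet> ((x + (r/2) *\<^sub>R y) - x) \<le> 0"
    by (rule xs) (use r in auto)
  then show "xs \<bullet> y \<le> 0" using r(1) by (simp add: mult_le_0_iff)
qed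

text \<open>For fixed \<open>y \<in> S\<close> the normality inequality is a closed condition on
  pairs; the graph is the intersection of all of them with \<open>S \<times> UNIV\<close>.\<close>

lemma closed_gph_normal_cone:
  fixes S :: "'a::euclidean_space set"
  assumes "closed S"
  shows "closed (gph (\<lambda>x. (\<lambda>w. c + w) ` normal_cone S x))"
proof -
  have "gph (\<lambda>x. (\<lambda>w. c + w) ` normal_cone S x) =
      (S \<times> UNIV) \<inter> (\<Inter>y\<in>S. {p. (snd p - c) \<bullet> (y - fst p) \<le> 0})"
  proof (intro set_eqI iffI)
    fix p assume p: "p \<in> (S \<times> UNIV) \<inter> (\<Inter>y\<in>S. {p. (snd p - c) \<bullet> (y - fst p) \<le> 0})"
    then have "snd p - c \<in> normal_cone S (fst p)" by (auto simp: normal_cone_def)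
    then have "snd p \<in> (\<lambda>w. c + w) ` normal_cone S (fst p)"
      by (metis add_diff_cancel_left' add_diff_eq image_eqI)
    then show "p \<in> gph (\<lambda>x. (\<lambda>w. c + w) ` normal_cone S x)"
      by (simp add: gph_def case_prod_beta)
  qed (auto simp: gph_def normal_cone_def split: if_splits)
  moreover have "closed {p::'a \<times> 'a. (snd p - c) \<bullet> (y - fst p) \<le> 0}" for y
    by (intro closed_Collect_le continuous_intros)
  ultimately show ?thesis
    using assms by (auto intro!: closed_Int closed_INT closed_Times)
qed

section \<open>The Aubin property of the shifted normal cone mapping\<close>

text \<open>The equality \<open>a i \<bullet> w = 0\<close> combines two effects of the Aubin
  property: points of \<open>C\<close> near \<open>xbar\<close> must have nonempty values and hence
  lie in \<open>\<Theta>\<close>, which gives \<open>\<le>\<close>, and a perturbed normal at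
  \<open>xbar\<close> must nearly persist at them, which gives \<open>\<ge>\<close>.\<close>

lemma aubin_normal_cone_iff:
  fixes a :: "nat \<Rightarrow> 'a::euclidean_space" and b c :: "nat \<Rightarrow> real" and I1 I2 :: "nat set"
  defines "\<Theta> \<equiv> {x. \<forall>i\<in>I1. a i \<bullet> x \<le> b i}" and "C \<equiv> {x. \<forall>i\<in>I2. a i \<bullet> x \<le> c i}"
  assumes fin: "finite I1" "finite I2" and "xbar \<in> C" and xs: "xs \<in> normal_cone \<Theta> xbar"
  shows "aubin_wrt (\<lambda>x. (\<lambda>w. - xs + w) ` normal_cone \<Theta> x) C xbar 0 \<longleftrightarrow>
    (\<forall>w \<in> T_set a (active I2 a c xbar). \<forall>i \<in> active I1 a b xbar. a i \<bullet> w = 0)"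
    (is "aubin_wrt ?G C xbar 0 \<longleftrightarrow> ?R")
proof -
  have xbar: "xbar \<in> \<Theta>" and normal: "\<And>y. y \<in> \<Theta> \<Longrightarrow> xs \<bullet> (y - xbar) \<le> 0"
    using xs by (auto simp: normal_cone_def split: if_splits)
  show ?thesis
  proof
    assume "aubin_wrt ?G C xbar 0"
    then obtain \<kappa> U V where \<kappa>: "\<kappa> \<ge> 0" and U: "open U" "xbar \<in> U" and V: "open V" "0 \<in> V"
      and sub: "\<And>x u. x \<in> C \<inter> U \<Longrightarrow> u \<in> C \<inter> U \<Longrightarrow>
        ?G u \<inter> V \<subseteq> ?G x + (*\<^sub>R) (\<kappa> * norm (u - x)) ` cball 0 1"
      unfolding aubin_wrt_def by (elim conjE exE) (metis (no_types, lifting))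
    obtain rU where rU: "rU > 0" "ball xbar rU \<subseteq> U" using U open_contains_ball by blast
    obtain rV where rV: "rV > 0" "ball 0 rV \<subseteq> V" using V open_contains_ball by blast
    show ?R
    proof (intro ballI)
      fix w i assume w: "w \<in> T_set a (active I2 a c xbar)" and i: "i \<in> active I1 a b xbar"
      have feasC: "a j \<bullet> xbar \<le> c j" if "j \<in> I2" for j using \<open>xbar \<in> C\<close> that by (simp add: C_def)
      obtain r where r: "r > 0" "\<And>t. 0 \<le> t \<Longrightarrow> t < r \<Longrightarrow> \<forall>j\<in>I2. a j \<bullet> (xbar + t *\<^sub>R w) \<le> c j"
        using tangent_direction_feasible[OF fin(2) feasC w] by metis
      \<comment> \<open>Steps shorter than \<open>\<rho>\<close> remain both in \<open>C\<close> and
        in \<open>U\<close>.\<close>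
      define \<rho> where "\<rho> = min r (rU / (norm w + 1))"
      have nw: "norm w + 1 > 0" by (auto intro: add_nonneg_pos)
      have \<rho>: "\<rho> > 0" using r(1) rU(1) nw by (simp add: \<rho>_def)
      have inCU: "xbar + t *\<^sub>R w \<in> C \<inter> U" if "0 \<le> t" "t < \<rho>" for t
      proof -
        have "t * (norm w + 1) < rU"
          using that(2) nw by (simp add: \<rho>_def pos_less_divide_eq)
        then have "xbar + t *\<^sub>R w \<in> ball xbar rU"
          using that(1) by (simp add: dist_norm algebra_simps)
        then show ?thesis using r(2)[of t] that rU(2) by (auto simp: \<rho>_def C_def)
      qed
      have xbarCU: "xbar \<in> C \<inter> U" using \<open>xbar \<in> C\<close> U by blast
      \<comment> \<open>This \<open>\<epsilon>\<close> puts the perturbation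
        \<open>\<epsilon> *\<^sub>R a i\<close> inside \<open>V\<close>; adding it to
        \<open>xs\<close> keeps normality because constraint \<open>i\<close> is active at
        \<open>xbar\<close>.\<close>
      define \<epsilon> where "\<epsilon> = rV / 2 / (norm (a i) + 1)"
      have ni: "norm (a i) + 1 > 0" by (auto intro: add_nonneg_pos)
      have \<epsilon>: "\<epsilon> > 0" using rV(1) ni by (simp add: \<epsilon>_def)
      have "\<epsilon> * (norm (a i) + 1) = rV / 2"
        using ni unfolding \<epsilon>_def by (metis less_irrefl nonzero_eq_divide_eq)
      then have "\<epsilon> * (norm (a i) + 1) < rV" using rV(1) by simp
      then have \<epsilon>V: "\<epsilon> *\<^sub>R a i \<in> V"
        using rV(2) \<epsilon> by (auto simp: dist_norm algebra_simps subset_iff)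
      have "xs + \<epsilon> *\<^sub>R a i \<in> normal_cone \<Theta> xbar"
      proof -
        have "(xs + \<epsilon> *\<^sub>R a i) \<bullet> (y - xbar) \<le> 0" if "y \<in> \<Theta>" for y
        proof -
          have "a i \<bullet> (y - xbar) \<le> 0"
            using that i by (auto simp: \<Theta>_def active_def inner_diff_right)
          then show ?thesis
            using normal[OF that] \<epsilon> by (simp add: inner_add_left mult_nonneg_nonpos add_nonpos_nonpos)
        qed
        then show ?thesis using xbar by (simp add: normal_cone_def)
      qed
      then have \<epsilon>G: "\<epsilon> *\<^sub>R a i \<in> ?G xbar" by (rule image_eqI[rotated]) simp
      \<comment> \<open>The Aubin inclusion from \<open>xbar\<close> to the shifted point yields a
        normal \<open>g\<close> there, whose mere existence gives membership in
        \<open>\<Theta>\<close>. Testing \<open>g\<close> with \<open>xbar\<close> gives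
        \<open>g \<bullet> w \<ge> 0\<close>, and the distance term contributes an error of order
        \<open>t\<close>.\<close>
      have key: "xbar + t *\<^sub>R w \<in> \<Theta> \<and> (xs + \<epsilon> *\<^sub>R a i) \<bullet> w \<ge> - (\<kappa> * t * (norm w * norm w))"
        if t: "0 < t" "t < \<rho>" for t
      proof -
        let ?x = "xbar + t *\<^sub>R w"
        have "\<epsilon> *\<^sub>R a i \<in> ?G ?x + (*\<^sub>R) (\<kappa> * norm (xbar - ?x)) ` cball 0 1"
          using sub[OF inCU xbarCU, of t] \<epsilon>V \<epsilon>G t by auto
        then obtain g e where g: "g \<in> normal_cone \<Theta> ?x" and e: "norm e \<le> 1"
          and eq: "\<epsilon> *\<^sub>R a i = (- xs + g) + (\<kappa> * norm (xbar - ?x)) *\<^sub>R e"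
          by (auto elim!: set_plus_elim)
        have feas: "?x \<in> \<Theta>" and "g \<bullet> (xbar - ?x) \<le> 0"
          using g xbar by (auto simp: normal_cone_def split: if_splits)
        then have gw: "g \<bullet> w \<ge> 0" using t(1) by (simp add: zero_le_mult_iff)
        have ew: "e \<bullet> w \<ge> - norm w"
        proof -
          have "\<bar>e \<bullet> w\<bar> \<le> norm e * norm w" by (rule Cauchy_Schwarz_ineq2)
          also have "\<dots> \<le> 1 * norm w" using e by (intro mult_right_mono) auto
          finally show ?thesis by simp
        qed
        have "xs + \<epsilon> *\<^sub>R a i = g + (\<kappa> * t * norm w) *\<^sub>R e"
          using eq t(1) by (simp add: algebra_simps)
        then have "(xs + \<epsilon> *\<^sub>R a i) \<bullet> w = g \<bullet> w + (\<kappa> * t * norm w) * (e \<bullet> w)"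
          by (simp add: inner_add_left)
        moreover have "(\<kappa> * t * norm w) * (e \<bullet> w) \<ge> (\<kappa> * t * norm w) * (- norm w)"
          using ew \<kappa> t(1) by (intro mult_left_mono) auto
        ultimately show ?thesis using feas gw by (simp add: mult.assoc)
      qed
      have lower: "(xs + \<epsilon> *\<^sub>R a i) \<bullet> w \<ge> 0"
      proof (rule tendsto_lowerbound)
        show "((\<lambda>t. (xs + \<epsilon> *\<^sub>R a i) \<bullet> w + \<kappa> * t * (norm w * norm w)) \<longlongrightarrow> (xs + \<epsilon> *\<^sub>R a i) \<bullet> w) (at_right 0)"
          by (auto intro!: tendsto_eq_intros)
        show "\<forall>\<^sub>F t in at_right 0. 0 \<le> (xs + \<epsilon> *\<^sub>R a i) \<bullet> w + \<kappa> * t * (norm w * norm w)"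
          unfolding eventually_at_right_field
          by (intro exI[of _ \<rho>]) (use key \<rho> in \<open>force simp: algebra_simps\<close>)
      qed simp
      \<comment> \<open>A feasible point in direction \<open>w\<close> bounds both
        \<open>xs \<bullet> w\<close> and \<open>a i \<bullet> w\<close> above by 0; with
        \<open>lower\<close> the latter must vanish.\<close>
      have feas: "xbar + (\<rho>/2) *\<^sub>R w \<in> \<Theta>" using key[of "\<rho>/2"] \<rho> by simp
      have "xs \<bullet> w \<le> 0" using normal[OF feas] \<rho> by (simp add: mult_le_0_iff)
      then have "a i \<bullet> w \<ge> 0"
        using lower \<epsilon> by (simp add: inner_add_left) (smt (verit) zero_le_mult_iff)
      moreover have "a i \<bullet> w \<le> 0"
      proof -
        have "a i \<bullet> (xbar + (\<rho>/2) *\<^sub>R w) \<le> a i \<bullet> xbar"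
          using feas i by (auto simp: \<Theta>_def active_def)
        then show ?thesis using \<rho> by (simp add: inner_add_right mult_le_0_iff)
      qed
      ultimately show "a i \<bullet> w = 0" by simp
    qed
  next
    assume R: ?R
    have "a i \<bullet> xbar < b i" if "i \<in> I1 - active I1 a b xbar" for i
      using that xbar by (force simp: active_def \<Theta>_def)
    then obtain r where r: "r > 0"
      "\<And>y i. y \<in> ball xbar r \<Longrightarrow> i \<in> I1 - active I1 a b xbar \<Longrightarrow> a i \<bullet> y < b i"
      using strict_inequalities_stable[of "I1 - active I1 a b xbar" a xbar b] fin(1) by blast
    \<comment> \<open>\<open>x - xbar\<close> is tangent to \<open>C\<close>, so \<open>?R\<close>
      keeps every constraint active at \<open>xbar\<close> tight on all of \<open>C\<close>.\<close>
    have active_const: "a i \<bullet> x = b i" if "x \<in> C" "i \<in> active I1 a b xbar" for x i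
    proof -
      have "x - xbar \<in> T_set a (active I2 a c xbar)"
        using that(1) by (auto simp: T_set_def active_def C_def inner_diff_right)
      then show ?thesis using R that(2) by (auto simp: active_def inner_diff_right)
    qed
    have in\<Theta>: "y \<in> \<Theta>" if "y \<in> ball xbar r" "\<And>i. i \<in> active I1 a b xbar \<Longrightarrow> a i \<bullet> y = b i" for y
      using r(2)[OF that(1)] that(2) by (force simp: \<Theta>_def)
    \<comment> \<open>The reflection \<open>u + (u - x)\<close> of \<open>x\<close> at
      \<open>u\<close> also lies in \<open>\<Theta>\<close>, so
      \<open>w \<bullet> (u - x) \<le> 0\<close>, and normality passes from \<open>u\<close> to
      \<open>x\<close>. The radius \<open>r/3\<close> keeps the reflection in
      \<open>ball xbar r\<close>.\<close>
    have sub: "normal_cone \<Theta> u \<subseteq> normal_cone \<Theta> x"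
      if x: "x \<in> C \<inter> ball xbar (r/3)" and u: "u \<in> C \<inter> ball xbar (r/3)" for x u
    proof
      fix w assume w: "w \<in> normal_cone \<Theta> u"
      have "x \<in> \<Theta>" using x r(1) active_const by (intro in\<Theta>) auto
      have refl: "u + (u - x) \<in> \<Theta>"
      proof (rule in\<Theta>)
        have "norm (xbar - (u + (u - x))) = norm ((xbar - u) + ((xbar - u) - (xbar - x)))"
          by (simp add: algebra_simps)
        also have "\<dots> \<le> norm (xbar - u) + (norm (xbar - u) + norm (xbar - x))"
          by (intro norm_triangle_le add_left_mono norm_triangle_ineq4)
        also have "\<dots> < r" using x u by (simp add: dist_norm)
        finally show "u + (u - x) \<in> ball xbar r" by (simp add: dist_norm)
      qed (use x u active_const in \<open>auto simp: inner_add_right inner_diff_right\<close>)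
      have "w \<bullet> (y - x) \<le> 0" if "y \<in> \<Theta>" for y
      proof -
        have "w \<bullet> (y - u) \<le> 0" and "w \<bullet> (u + (u - x) - u) \<le> 0"
          using w that refl by (auto simp: normal_cone_def split: if_splits)
        then show ?thesis by (simp add: inner_diff_right)
      qed
      then show "w \<in> normal_cone \<Theta> x" using \<open>x \<in> \<Theta>\<close> by (simp add: normal_cone_def)
    qed
    have "closed \<Theta>"
    proof -
      have "\<Theta> = (\<Inter>i\<in>I1. {x. a i \<bullet> x \<le> b i})" by (auto simp: \<Theta>_def)
      then show ?thesis by (auto intro: closed_halfspace_le)
    qed
    then have "locally_closed_around (gph ?G) (xbar, 0)"
      unfolding locally_closed_around_def
      using closed_gph_normal_cone[of \<Theta> "- xs"] by (intro exI[of _ UNIV]) simp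
    moreover have "(xbar, 0) \<in> gph ?G"
      using xs by (force simp: gph_def)
    \<comment> \<open>Nearby normal cones contain each other, so \<open>\<kappa> = 0\<close> and
      \<open>V = UNIV\<close> will do.\<close>
    moreover have "?G u \<inter> UNIV \<subseteq> ?G x + (*\<^sub>R) (0 * norm (u - x)) ` cball 0 1"
      if "x \<in> C \<inter> ball xbar (r/3)" "u \<in> C \<inter> ball xbar (r/3)" for x u
    proof
      fix y assume "y \<in> ?G u \<inter> UNIV"
      then have "y \<in> ?G x" using sub[OF that] by blast
      moreover have "0 \<in> (*\<^sub>R) (0 * norm (u - x)) ` cball (0::'a) 1" by (rule image_eqI[of _ _ 0]) auto
      ultimately have "y + 0 \<in> ?G x + (*\<^sub>R) (0 * norm (u - x)) ` cball 0 1"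
        by (rule set_plus_intro)
      then show "y \<in> ?G x + (*\<^sub>R) (0 * norm (u - x)) ` cball 0 1" by simp
    qed
    ultimately show "aubin_wrt ?G C xbar 0"
      unfolding aubin_wrt_def using r(1)
      by (intro conjI exI[of _ 0] exI[of _ "ball xbar (r/3)"] exI[of _ UNIV] ballI) auto
  qed
qed

section \<open>The trivial intersection condition and the tangent cone of \<open>C\<close>\<close>

text \<open>Adding a multiple of \<open>w\<close> moves \<open>v\<close> into
  \<open>T_set a K2\<close>, whence \<open>a i \<bullet> v = 0\<close> for
  \<open>i \<in> K1\<close>. Then the cone part of \<open>v\<close> has nonpositive product with
  \<open>v\<close> and the span part has product 0, so \<open>v \<bullet> v \<le> 0\<close>.\<close>

lemma A_set_inter_T_set_trivial:
  fixes a :: "nat \<Rightarrow> 'a::real_inner"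
  assumes "finite K2" and "Q \<subseteq> K1 \<union> K2" and "P \<subseteq> K1"
    and tangent: "\<And>w i. w \<in> T_set a K2 \<Longrightarrow> i \<in> K1 \<Longrightarrow> a i \<bullet> w = 0"
    and w: "w \<in> C_set a (K1 \<union> K2) Q" and v: "v \<in> A_set a Q P" "v \<in> T_set a (Q \<inter> K2)"
  shows "v = 0"
proof -
  have w0: "a i \<bullet> w = 0" if "i \<in> Q" for i
    using w that by (auto simp: C_set_def)
  have wneg: "a i \<bullet> w < 0" if "i \<in> K2 - Q" for i
    using w that by (auto simp: C_set_def)
  have wT: "w \<in> T_set a K2"
    using w0 wneg by (force simp: T_set_def)
  obtain t where "t \<ge> 0" and t: "\<And>i. i \<in> K2 - Q \<Longrightarrow> a i \<bullet> (v + t *\<^sub>R w) \<le> 0"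
    using strict_direction_dominates[of "K2 - Q" a w v] assms(1) wneg by blast
  have "a i \<bullet> (v + t *\<^sub>R w) \<le> 0" if "i \<in> K2 \<inter> Q" for i
    using that v(2) w0[of i] by (auto simp: T_set_def inner_add_right)
  with t have vT: "v + t *\<^sub>R w \<in> T_set a K2" by (auto simp: T_set_def)
  have v0: "a i \<bullet> v = 0" if "i \<in> K1" for i
    using tangent[OF vT that] tangent[OF wT that] by (simp add: inner_add_right)
  obtain p q where pq: "v = p + q" "p \<in> convex_cone hull (a ` (Q - P))" "q \<in> span (a ` P)"
    using v(1) by (auto simp: A_set_def elim: set_plus_elim)
  have "p \<bullet> v \<le> 0"
  proof (rule inner_convex_cone_hull_nonpos[OF pq(2)])
    fix z assume "z \<in> a ` (Q - P)"
    then obtain i where "i \<in> Q" "z = a i" by blast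
    then show "z \<bullet> v \<le> 0"
      using v0[of i] v(2) assms(2) by (auto simp: T_set_def)
  qed
  moreover have "q \<bullet> v = 0"
    by (rule inner_span_eq_0[OF pq(3)]) (use v0 assms(3) in auto)
  ultimately have "v \<bullet> v \<le> 0" using pq(1) by (metis add_0_right inner_add_left)
  then show ?thesis by (metis inner_gt_zero_iff not_le)
qed

text \<open>The span summand supplies both signs of the generators in \<open>P\<close>, and
  \<open>neg\<close> does so for the others; a convex cone with both signs contains every linear
  combination.\<close>

lemma span_subset_A_set:
  assumes "P \<subseteq> Q" and neg: "\<And>j. j \<in> Q - P \<Longrightarrow> - a j \<in> A_set a Q P"
  shows "span (a ` Q) \<subseteq> A_set a Q P"
proof -
  let ?A = "A_set a Q P"
  have "?A = (\<Union>x\<in>convex_cone hull (a ` (Q - P)). \<Union>y\<in>span (a ` P). {x + y})"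
    by (auto simp: A_set_def set_plus_def)
  then have cone: "convex_cone ?A"
    by (simp add: convex_cone_sums convex_cone_convex_cone_hull convex_cone_span)
  have gen1: "a j \<in> ?A" if "j \<in> Q - P" for j
    using set_plus_intro[OF hull_inc[of "a j" "a ` (Q - P)" convex_cone] span_zero[of "a ` P"]] that
    by (simp add: A_set_def)
  have gen2: "a j \<in> ?A" "- a j \<in> ?A" if "j \<in> P" for j
    using set_plus_intro[OF convex_cone_hull_contains_0[of "a ` (Q - P)"], of "a j" "span (a ` P)"]
      set_plus_intro[OF convex_cone_hull_contains_0[of "a ` (Q - P)"], of "- a j" "span (a ` P)"] that
    by (auto simp: A_set_def span_base span_neg)
  have gen: "a j \<in> ?A \<and> - a j \<in> ?A" if "j \<in> Q" for j
    using gen1 gen2 neg that by blast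
  have "c *\<^sub>R a j \<in> ?A" if "j \<in> Q" for c j
  proof (cases "c \<ge> 0")
    case True
    then show ?thesis using gen[OF that] convex_cone_scaleR[OF cone] by blast
  next
    case False
    then show ?thesis using gen[OF that] convex_cone_scaleR[OF cone, of "- c" "- a j"] by simp
  qed
  then have step: "c *\<^sub>R x + y \<in> ?A" if "x \<in> a ` Q" "y \<in> ?A" for c x y
    using that convex_cone_add[OF cone] by blast
  show ?thesis
  proof
    fix x assume "x \<in> span (a ` Q)"
    then show "x \<in> ?A"
      by (induction rule: span_induct_alt) (use step convex_cone_contains_0[OF cone] in auto)
  qed
qed

text \<open>The last property expresses relative interiority: a constraint tight at \<open>w\<close>
  is tight on the whole cone of tangent directions orthogonal to \<open>K1\<close>. Summing one
  witness for each constraint that can be strict achieves it, since nonpositive terms cannot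
  cancel.\<close>

lemma relative_interior_direction:
  fixes a :: "nat \<Rightarrow> 'a::real_inner"
  assumes "finite K2"
  obtains w where "w \<in> T_set a K2" and "\<And>i. i \<in> K1 \<Longrightarrow> a i \<bullet> w = 0"
    and "\<And>j y. j \<in> K2 \<Longrightarrow> a j \<bullet> w = 0 \<Longrightarrow> y \<in> T_set a K2 \<Longrightarrow> (\<And>i. i \<in> K1 \<Longrightarrow> a i \<bullet> y = 0) \<Longrightarrow> a j \<bullet> y = 0"
proof -
  define L where "L = {y \<in> T_set a K2. \<forall>i\<in>K1. a i \<bullet> y = 0}"
  \<comment> \<open>The default \<open>0\<close> lies in \<open>L\<close>, so
    \<open>f j \<in> L\<close> whether or not constraint \<open>j\<close> can be strict.\<close>
  define f where "f j = (if \<exists>y\<in>L. a j \<bullet> y < 0 then SOME y. y \<in> L \<and> a j \<bullet> y < 0 else 0)" for j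
  have f1: "f j \<in> L \<and> a j \<bullet> f j < 0" if "\<exists>y\<in>L. a j \<bullet> y < 0" for j
  proof -
    have "\<exists>y. y \<in> L \<and> a j \<bullet> y < 0" using that by blast
    from someI_ex[OF this] show ?thesis using that by (simp add: f_def)
  qed
  have fL: "f j \<in> L" for j
  proof (cases "\<exists>y\<in>L. a j \<bullet> y < 0")
    case False
    then show ?thesis by (auto simp: f_def L_def T_set_def)
  qed (use f1 in blast)
  let ?w = "\<Sum>j\<in>K2. f j"
  show thesis
  proof (rule that[of ?w])
    show "?w \<in> T_set a K2"
      using fL by (auto simp: T_set_def L_def inner_sum_right intro!: sum_nonpos)
    show "a i \<bullet> ?w = 0" if "i \<in> K1" for i
      using fL that by (auto simp: L_def inner_sum_right intro!: sum.neutral)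
    fix j y assume j: "j \<in> K2" "a j \<bullet> ?w = 0" and y: "y \<in> T_set a K2" "\<And>i. i \<in> K1 \<Longrightarrow> a i \<bullet> y = 0"
    have "a j \<bullet> f k \<le> 0" for k
      using fL[of k] j(1) by (auto simp: L_def T_set_def)
    then have "a j \<bullet> f j = 0"
      using j assms sum_nonneg_eq_0_iff[of K2 "\<lambda>k. - (a j \<bullet> f k)"] by (simp add: inner_sum_right sum_negf)
    then have "\<not> (\<exists>y\<in>L. a j \<bullet> y < 0)" using f1 by force
    then have "a j \<bullet> y \<ge> 0" using y by (force simp: L_def)
    moreover have "a j \<bullet> y \<le> 0" using y(1) j(1) by (auto simp: T_set_def)
    ultimately show "a j \<bullet> y = 0" by simp
  qed
qed

lemma inner_T_set_eq_0_of_A_set_trivial: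
  fixes a :: "nat \<Rightarrow> 'a::euclidean_space"
  assumes fin: "finite K1" "finite K2" and disj: "K1 \<inter> K2 = {}"
    and trivial: "\<And>Q v. Q \<subseteq> K1 \<union> K2 \<Longrightarrow> C_set a (K1 \<union> K2) Q \<noteq> {} \<Longrightarrow> K1 \<subseteq> Q \<Longrightarrow>
      v \<in> A_set a Q K1 \<Longrightarrow> v \<in> T_set a (Q \<inter> K2) \<Longrightarrow> v = 0"
    and u: "u \<in> T_set a K2" and i: "i \<in> K1"
  shows "a i \<bullet> u = 0"
proof -
  obtain w where w: "w \<in> T_set a K2" "\<And>i. i \<in> K1 \<Longrightarrow> a i \<bullet> w = 0"
    and relint: "\<And>j y. j \<in> K2 \<Longrightarrow> a j \<bullet> w = 0 \<Longrightarrow> y \<in> T_set a K2 \<Longrightarrow>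
      (\<And>i. i \<in> K1 \<Longrightarrow> a i \<bullet> y = 0) \<Longrightarrow> a j \<bullet> y = 0"
    using relative_interior_direction[OF fin(2), of a K1] by metis
  \<comment> \<open>For this \<open>Q\<close> the vector \<open>w\<close> itself shows that
    \<open>C_set\<close> is nonempty.\<close>
  define Q where "Q = K1 \<union> {j \<in> K2. a j \<bullet> w = 0}"
  have wC: "w \<in> C_set a (K1 \<union> K2) Q"
    using w by (force simp: C_set_def Q_def T_set_def)
  have QK: "Q - K1 = {j \<in> K2. a j \<bullet> w = 0}" using disj by (auto simp: Q_def)
  \<comment> \<open>Farkas tests \<open>- a j\<close> on vectors \<open>y\<close> orthogonal to
    \<open>K1\<close> and nonpositive on \<open>Q - K1\<close>. A multiple of \<open>w\<close>
    brings \<open>y\<close> into \<open>T_set a K2\<close> without changing products over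
    \<open>Q\<close>, and there \<open>relint\<close> forces
    \<open>a j \<bullet> y = 0\<close>.\<close>
  have neg: "- a j \<in> A_set a Q K1" if j: "j \<in> Q - K1" for j
  proof -
    let ?X = "a ` (Q - K1)" and ?Y = "a ` K1 \<union> uminus ` a ` K1"
    have "- a j \<in> convex_cone hull (?X \<union> ?Y)"
    proof (rule convex_cone_hull_farkas)
      show "finite (?X \<union> ?Y)" using fin by (simp add: QK)
      fix y assume y: "\<And>x. x \<in> ?X \<union> ?Y \<Longrightarrow> x \<bullet> y \<le> 0"
      have y0: "a i \<bullet> y = 0" if "i \<in> K1" for i
        using y[of "a i"] y[of "- a i"] that by auto
      have "a k \<bullet> w < 0" if "k \<in> K2 - Q" for k
        using that w(1) by (force simp: Q_def T_set_def)
      then obtain t where t: "t \<ge> 0" "\<And>k. k \<in> K2 - Q \<Longrightarrow> a k \<bullet> (y + t *\<^sub>R w) \<le> 0"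
        using strict_direction_dominates[of "K2 - Q" a w y] fin(2) by blast
      have "a k \<bullet> (y + t *\<^sub>R w) \<le> 0" if "k \<in> K2 \<inter> Q" for k
      proof -
        have "k \<in> Q - K1" using that disj by blast
        then show ?thesis using y[of "a k"] by (auto simp: QK inner_add_right)
      qed
      with t(2) have "y + t *\<^sub>R w \<in> T_set a K2" by (auto simp: T_set_def)
      then have "a j \<bullet> (y + t *\<^sub>R w) = 0"
        using relint[of j "y + t *\<^sub>R w"] j QK y0 w(2) by (auto simp: inner_add_right)
      then show "- a j \<bullet> y \<le> 0" using j QK by (simp add: inner_add_right)
    qed
    also have "convex_cone hull (?X \<union> ?Y) = (\<Union>x\<in>convex_cone hull ?X. \<Union>y\<in>convex_cone hull ?Y. {x + y})"
      by (rule convex_cone_hull_Un)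
    also have "\<dots> \<subseteq> A_set a Q K1"
    proof -
      have "convex_cone hull ?Y \<subseteq> span (a ` K1)"
        by (intro hull_minimal convex_cone_span) (auto intro: span_base span_neg)
      then show ?thesis by (auto simp: A_set_def)
    qed
    finally show ?thesis .
  qed
  have span: "span (a ` Q) \<subseteq> A_set a Q K1"
    by (rule span_subset_A_set[OF _ neg]) (auto simp: Q_def)
  \<comment> \<open>\<open>m\<close> is the projection of \<open>u\<close> onto the span of the
    vectors indexed by \<open>Q\<close>. Its products with them agree with those of
    \<open>u\<close>, so it inherits the constraints, and \<open>trivial\<close> makes it 0.\<close>
  obtain m n where m: "m \<in> span (a ` Q)" and n: "\<And>z. z \<in> span (a ` Q) \<Longrightarrow> orthogonal n z"
    and umn: "u = m + n"
    using orthogonal_subspace_decomp_exists[of "a ` Q" u] by metis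
  have am: "a k \<bullet> u = a k \<bullet> m" if "k \<in> Q" for k
    using n[of "a k"] that umn by (simp add: span_base orthogonal_def inner_add_right inner_commute)
  have "m \<in> T_set a (Q \<inter> K2)" using am u by (auto simp: T_set_def)
  then have "m = 0"
    using trivial[of Q m] wC m span by (auto simp: Q_def)
  then show ?thesis using am[of i] i by (simp add: Q_def)
qed

section \<open>Independent generators and the two characterizations\<close>

text \<open>The component of \<open>a i\<close> orthogonal to the other vectors serves, and
  independence makes it nonzero. By injectivity, removing the index \<open>i\<close> removes exactly
  the vector \<open>a i\<close>.\<close>

lemma independent_family_direction:
  fixes a :: "nat \<Rightarrow> 'a::euclidean_space"
  assumes "inj_on a K" and "independent (a ` K)" and "i \<in> K"
  obtains w where "a i \<bullet> w \<noteq> 0" and "\<And>j. j \<in> K \<Longrightarrow> j \<noteq> i \<Longrightarrow> a j \<bullet> w = 0"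
proof -
  let ?S = "a ` (K - {i})"
  have "a ` K - {a i} = ?S" using assms(1,3) by (auto simp: inj_on_def)
  then have notin: "a i \<notin> span ?S"
    using assms(2,3) by (auto simp: dependent_def)
  obtain m n where m: "m \<in> span ?S" and n: "\<And>z. z \<in> span ?S \<Longrightarrow> orthogonal n z" and eq: "a i = m + n"
    using orthogonal_subspace_decomp_exists[of ?S "a i"] by metis
  have "n \<noteq> 0" using m eq notin by auto
  moreover have "a i \<bullet> n = n \<bullet> n"
    using n[OF m] eq by (simp add: inner_add_left inner_add_right orthogonal_def inner_commute)
  ultimately have "a i \<bullet> n \<noteq> 0" by simp
  moreover have "a j \<bullet> n = 0" if "j \<in> K" "j \<noteq> i" for j
    using n[of "a j"] that by (auto simp: span_base orthogonal_def inner_commute)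
  ultimately show thesis by (rule that)
qed

text \<open>Independence of the family is expressed by injectivity on \<open>Ibar\<close> together
  with independence of the image. Since \<open>J\<close> and \<open>lam\<close> are universally
  quantified, (ii) holds for every representation of \<open>xs\<close>.\<close>

theorem theorem5p1:
  fixes a :: "nat \<Rightarrow> real ^ 'n" and b :: "nat \<Rightarrow> real" and l1 l :: nat
    and I1 I2 Ibar :: "nat set" and \<Theta> C :: "(real ^ 'n) set"
    and xbar xs :: "real ^ 'n" and G :: "real ^ 'n \<Rightarrow> (real ^ 'n) set"
  assumes "l1 \<le> l" and "I1 = {1..l1}" and "I2 = {l1 + 1..l}"
    and "\<Theta> = {x. \<forall>i\<in>I1. a i \<bullet> x \<le> b i}"
    and "C = {x. \<forall>i\<in>I2. a i \<bullet> x \<le> 0}"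
    and "xbar \<in> C" and "(xbar, xs) \<in> gph (normal_cone \<Theta>)"
    and "Ibar = active I1 a b xbar \<union> active I2 a (\<lambda>_. 0) xbar"
    and "G = (\<lambda>x. (\<lambda>w. - xs + w) ` normal_cone \<Theta> x)"
  shows
    "(aubin_wrt G C xbar 0 \<longleftrightarrow>
        (\<forall>Q P. Q \<subseteq> Ibar \<and> P \<in> P_sets I1 a b xbar xs \<and> C_set a Ibar Q \<noteq> {} \<and> P \<subseteq> Q \<inter> I1 \<longrightarrow>
          (\<forall>v. (v, 0) \<in> (A_set a Q P \<inter> T_set a (Q \<inter> I2)) \<times> B_set a (Q \<inter> I1) P \<longrightarrow> v = 0)))
     \<and>
     (inj_on a Ibar \<and> independent (a ` Ibar) \<longrightarrow>
       (\<forall>J lam. J \<subseteq> active I1 a b xbar \<and> (\<forall>i\<in>J. lam i \<ge> 0) \<and> xs = (\<Sum>i\<in>J. lam i *\<^sub>R a i) \<longrightarrow>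
         (aubin_wrt G C xbar 0 \<longleftrightarrow>
           (\<forall>Q P. Q \<subseteq> Ibar \<and> {i\<in>J. lam i > 0} \<subseteq> P \<and> P \<subseteq> Q \<inter> I1 \<longrightarrow>
             (\<forall>v. (v, 0) \<in> (A_set a Q P \<inter> T_set a (Q \<inter> I2)) \<times> B_set a (Q \<inter> I1) P \<longrightarrow> v = 0)))))"
proof -
  let ?K1 = "active I1 a b xbar" and ?K2 = "active I2 a (\<lambda>_. 0) xbar"
  let ?trivial = "\<lambda>Q P. \<forall>v. (v, 0) \<in> (A_set a Q P \<inter> T_set a (Q \<inter> I2)) \<times> B_set a (Q \<inter> I1) P \<longrightarrow> v = 0"
  have fin: "finite I1" "finite I2" and disj: "I1 \<inter> I2 = {}"
    using assms(2,3) by auto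
  have K: "?K1 \<subseteq> I1" "?K2 \<subseteq> I2" "?K1 \<inter> ?K2 = {}" "finite ?K1" "finite ?K2"
    using fin disj by (auto simp: active_def)
  have Ibar: "Ibar = ?K1 \<union> ?K2" by (rule assms(8))
  have QI: "Q \<inter> I2 = Q \<inter> ?K2" "Q \<inter> I1 = Q \<inter> ?K1" if "Q \<subseteq> Ibar" for Q
    using that K disj Ibar by auto
  have xs: "xs \<in> normal_cone \<Theta> xbar" using assms(7) by (simp add: gph_def)
  have xs_cone: "xs \<in> convex_cone hull (a ` ?K1)"
    using normal_cone_polyhedron_subset[OF fin(1)] xs assms(4) by blast
  have aubin: "aubin_wrt G C xbar 0 \<longleftrightarrow> (\<forall>w \<in> T_set a ?K2. \<forall>i \<in> ?K1. a i \<bullet> w = 0)"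
    using aubin_normal_cone_iff[OF fin, of xbar a "\<lambda>_. 0" xs b] assms(4,5,6,9) xs by simp
  have triv: "?trivial Q P \<longleftrightarrow> (\<forall>v. v \<in> A_set a Q P \<and> v \<in> T_set a (Q \<inter> I2) \<longrightarrow> v = 0)" for Q P
    by (auto simp: B_set_def T_set_def)
  have part1: "aubin_wrt G C xbar 0 \<longleftrightarrow>
      (\<forall>Q P. Q \<subseteq> Ibar \<and> P \<in> P_sets I1 a b xbar xs \<and> C_set a Ibar Q \<noteq> {} \<and> P \<subseteq> Q \<inter> I1 \<longrightarrow> ?trivial Q P)"
    (is "_ \<longleftrightarrow> ?cond")
  proof
    assume "aubin_wrt G C xbar 0"
    then have tangent: "\<And>w i. w \<in> T_set a ?K2 \<Longrightarrow> i \<in> ?K1 \<Longrightarrow> a i \<bullet> w = 0" using aubin by blast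
    show ?cond
      unfolding triv
    proof (intro allI impI, elim conjE)
      fix Q P v
      assume H: "Q \<subseteq> Ibar" "P \<subseteq> Q \<inter> I1" "C_set a Ibar Q \<noteq> {}"
        and v: "v \<in> A_set a Q P" "v \<in> T_set a (Q \<inter> I2)"
      obtain w where "w \<in> C_set a (?K1 \<union> ?K2) Q" using H(3) Ibar by auto
      then show "v = 0"
        using A_set_inter_T_set_trivial[OF K(5) _ _ tangent, where Q = Q and P = P and v = v and w = w]
          H v QI[OF H(1)] Ibar by auto
    qed
  next
    assume cond: ?cond
    \<comment> \<open>\<open>P = ?K1\<close> is admissible because the normal \<open>xs\<close> lies
      in the cone of the active generators.\<close>
    have "?K1 \<in> P_sets I1 a b xbar xs" using xs_cone by (simp add: P_sets_def)
    then have "v = 0" if "Q \<subseteq> ?K1 \<union> ?K2" "C_set a (?K1 \<union> ?K2) Q \<noteq> {}" "?K1 \<subseteq> Q"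
      "v \<in> A_set a Q ?K1" "v \<in> T_set a (Q \<inter> ?K2)" for Q v
      using cond[unfolded triv, rule_format, of Q ?K1 v] that K(1) QI[of Q] Ibar by auto
    then show "aubin_wrt G C xbar 0"
      using inner_T_set_eq_0_of_A_set_trivial[OF K(4,5,3), of a] aubin by blast
  qed
  have part2: "aubin_wrt G C xbar 0 \<longleftrightarrow>
      (\<forall>Q P. Q \<subseteq> Ibar \<and> {i\<in>J. lam i > 0} \<subseteq> P \<and> P \<subseteq> Q \<inter> I1 \<longrightarrow> ?trivial Q P)"
    (is "_ \<longleftrightarrow> ?cond")
    if ind: "inj_on a Ibar" "independent (a ` Ibar)" and J: "J \<subseteq> ?K1"
    for J and lam :: "nat \<Rightarrow> real"
  proof -
    \<comment> \<open>For \<open>i \<in> ?K1\<close>, independence gives a direction orthogonal to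
      all other active vectors but not to \<open>a i\<close>. It is tangent to \<open>C\<close>,
      contradicting \<open>aubin\<close>.\<close>
    have "aubin_wrt G C xbar 0 \<longleftrightarrow> ?K1 = {}"
    proof
      assume L: "aubin_wrt G C xbar 0"
      show "?K1 = {}"
      proof (rule ccontr)
        assume "?K1 \<noteq> {}"
        then obtain i where i: "i \<in> ?K1" by blast
        then obtain w where w: "a i \<bullet> w \<noteq> 0" "\<And>j. j \<in> Ibar \<Longrightarrow> j \<noteq> i \<Longrightarrow> a j \<bullet> w = 0"
          using independent_family_direction[OF ind] Ibar by blast
        have "a j \<bullet> w = 0" if "j \<in> ?K2" for j
          using that w(2)[of j] i K(3) Ibar by blast
        then have "w \<in> T_set a ?K2" by (simp add: T_set_def)
        then show False using L aubin i w(1) by blast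
      qed
    qed (simp add: aubin)
    also have "\<dots> \<longleftrightarrow> ?cond"
    proof
      assume K1: "?K1 = {}"
      show ?cond
        unfolding triv
      proof (intro allI impI, elim conjE)
        fix Q P v
        assume H: "Q \<subseteq> Ibar" "P \<subseteq> Q \<inter> I1" and v: "v \<in> A_set a Q P" "v \<in> T_set a (Q \<inter> I2)"
        \<comment> \<open>With \<open>P\<close> empty, \<open>v\<close> lies both in the cone of the
          vectors indexed by \<open>Q\<close> and in its polar.\<close>
        have "P = {}" "Q \<inter> I2 = Q" using H QI[OF H(1)] K1 Ibar by auto
        then have "v \<in> convex_cone hull (a ` Q)" "\<And>i. i \<in> Q \<Longrightarrow> a i \<bullet> v \<le> 0"
          using v by (auto simp: A_set_def T_set_def elim: set_plus_elim)
        then have "v \<bullet> v \<le> 0" by (auto intro: inner_convex_cone_hull_nonpos)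
        then show "v = 0" by (metis inner_gt_zero_iff not_le)
      qed
    next
      assume cond: ?cond
      show "?K1 = {}"
      proof (rule ccontr)
        assume "?K1 \<noteq> {}"
        then obtain i where i: "i \<in> ?K1" by blast
        \<comment> \<open>Take \<open>Q = P = ?K1\<close>: \<open>A_set\<close> becomes a span and
          \<open>T_set\<close> the whole space, so \<open>a i\<close> itself is a test vector, and
          independence excludes \<open>a i = 0\<close>.\<close>
        have "a i \<in> A_set a ?K1 ?K1"
          using i by (simp add: A_set_def span_base)
        moreover have "a i \<in> T_set a (?K1 \<inter> I2)"
          using K(1) disj by (auto simp: T_set_def)
        ultimately have "a i = 0"
          using cond[unfolded triv, rule_format, of ?K1 ?K1 "a i"] J K(1) Ibar by blast
        then show False using ind(2) i Ibar dependent_zero[of "a ` Ibar"] by (metis UnI1 image_eqI)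
      qed
    qed
    finally show ?thesis .
  qed
  show ?thesis
    by (intro conjI part1 impI allI part2; elim conjE; assumption)
qed

end
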